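(* Let $G=(V,E)$ be an undirected graph with positive edge weights $c:E\to\mathbb{R}_{+}$, let $t\ge1$, and let $T_\ell\subseteq\cdots\subseteq T_1\subseteq V$ be nested terminal sets. Consider the oracle top-down algorithm: let $G_\ell$ be a minimum-cost subsetwise $(T_\ell\times T_\ell)$-spanner of $G$ with stretch factor $t$, and for $i=\ell-1,\dots,1$ let $G_i$ be the union of $G_{i+1}$ and a minimum-cost subsetwise $(T_i\times T_i)$-spanner of $G$ with stretch factor $t$. Let $\mathrm{TOP}_i$ denote the total weight of edges in $G_i$ but not in $G_{i+1}$ (with $G_{\ell+1}$ empty), and $\mathrm{TOP}=\sum_{i=1}^{\ell}\sum_{e\in E(G_i)}c_e=\sum_{i=1}^\ell i\,\mathrm{TOP}_i$. Let $G^*_\ell\subseteq\cdots\subseteq G^*_1$ be an optimal MLGS solution of cost $\mathrm{OPT}$, and let $\mathrm{OPT}_i$ denote the total weight of edges in $G^*_i$ but not in $G^*_{i+1}$ (with $G^*_{\ell+1}$ empty), so that $\mathrm{OPT}=\sum_{i=1}^\ell i\,\mathrm{OPT}_i$. Then: (i) $\mathrm{TOP}_\ell\le\mathrm{OPT}_\ell$; (ii) $\mathrm{TOP}_i\le \mathrm{OPT}_i+\mathrm{OPT}_{i+1}+\cdots+\mathrm{OPT}_\ell$ for $i=1,\dots,\ell-1$; (iii) $\mathrm{TOP}\le\frac{\ell+1}{2}\,\mathrm{OPT}$.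
   Context: For a weighted graph $G$, $d_G(u,v)$ denotes the length of a shortest $u$–$v$ path in $G$ with respect to $c$. Given $S\subseteq V$ and $t\ge1$, a subgraph $H$ of $G$ is a subsetwise $(S\times S)$-spanner of $G$ with stretch factor $t$ if $d_H(u,v)\le t\cdot d_G(u,v)$ for all $u,v\in S$; its cost is the sum of the weights of its edges. The multi-level graph spanner (MLGS) problem: given $G$, $c$, nested terminals $T_\ell\subseteq\cdots\subseteq T_1\subseteq V$ and $t\ge1$, find subgraphs $G_\ell\subseteq G_{\ell-1}\subseteq\cdots\subseteq G_1$ of $G$ such that each $G_i$ is a subsetwise $(T_i\times T_i)$-spanner of $G$ with stretch factor $t$, minimizing the cost $\sum_{i=1}^{\ell}\sum_{e\in E(G_i)}c_e$. *)

theory Defs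
  imports
    "Graph_Theory.Digraph_Component"
    "Graph_Theory.Shortest_Path"
begin

text \<open>
  Undirected simple graphs are the symmetric digraphs of the locale \<^locale>\<open>graph\<close>: an undirected
  edge \<open>{u, v}\<close> is a pair of opposite arcs. Weights live on undirected edges, so each edge is
  counted once in a cost although it is represented by two arcs.
\<close>

definition edges :: "('a, 'b) pre_digraph \<Rightarrow> 'a set set" where
  "edges H = (\<lambda>a. {tail H a, head H a}) ` arcs H"

definition cost :: "('a set \<Rightarrow> real) \<Rightarrow> ('a, 'b) pre_digraph \<Rightarrow> real" where
  "cost c H = (\<Sum>e\<in>edges H. c e)"

text \<open>
  The distance is an \<^typ>\<open>ereal\<close>, with value \<open>\<infinity>\<close> if there is no path from \<open>u\<close> to \<open>v\<close>
  (in particular if \<open>u\<close> or \<open>v\<close> is not a vertex of \<open>H\<close>). For nonnegative weights on a finite graph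
  the infimum over walks is the length of a shortest path, see \<open>fin_digraph.min_cost_awalk\<close>.
\<close>

definition graph_dist :: "('a set \<Rightarrow> real) \<Rightarrow> ('a, 'b) pre_digraph \<Rightarrow> 'a \<Rightarrow> 'a \<Rightarrow> ereal" where
  "graph_dist c H u v = wf_digraph.\<mu> H (\<lambda>a. c {tail H a, head H a}) u v"

text \<open>\<^term>\<open>graph H\<close> forces \<open>H\<close> to contain both or none of the two arcs of an edge of \<open>G\<close>.\<close>

definition subset_spanner ::
  "('a, 'b) pre_digraph \<Rightarrow> ('a set \<Rightarrow> real) \<Rightarrow> real \<Rightarrow> 'a set \<Rightarrow> ('a, 'b) pre_digraph \<Rightarrow> bool" where
  "subset_spanner G c t S H \<longleftrightarrow>
     graph H \<and> subgraph H G \<and>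
     (\<forall>u\<in>S. \<forall>v\<in>S. graph_dist c H u v \<le> ereal t * graph_dist c G u v)"

definition min_cost_subset_spanner ::
  "('a, 'b) pre_digraph \<Rightarrow> ('a set \<Rightarrow> real) \<Rightarrow> real \<Rightarrow> 'a set \<Rightarrow> ('a, 'b) pre_digraph \<Rightarrow> bool" where
  "min_cost_subset_spanner G c t S H \<longleftrightarrow>
     subset_spanner G c t S H \<and> (\<forall>K. subset_spanner G c t S K \<longrightarrow> cost c H \<le> cost c K)"

text \<open>
  A family of graphs is a function on \<^typ>\<open>nat\<close> of which only the values at the levels \<open>1, \<dots>, l\<close>
  matter; level \<open>l\<close> is the top one.
\<close>

definition mlgs_feasible ::
  "('a, 'b) pre_digraph \<Rightarrow> ('a set \<Rightarrow> real) \<Rightarrow> real \<Rightarrow> nat \<Rightarrow> (nat \<Rightarrow> 'a set)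
    \<Rightarrow> (nat \<Rightarrow> ('a, 'b) pre_digraph) \<Rightarrow> bool" where
  "mlgs_feasible G c t l T Gs \<longleftrightarrow>
     (\<forall>i\<in>{1..l}. subset_spanner G c t (T i) (Gs i)) \<and>
     (\<forall>i\<in>{1..<l}. subgraph (Gs (Suc i)) (Gs i))"

definition mlgs_cost ::
  "('a set \<Rightarrow> real) \<Rightarrow> nat \<Rightarrow> (nat \<Rightarrow> ('a, 'b) pre_digraph) \<Rightarrow> real" where
  "mlgs_cost c l Gs = (\<Sum>i=1..l. cost c (Gs i))"

definition mlgs_optimal ::
  "('a, 'b) pre_digraph \<Rightarrow> ('a set \<Rightarrow> real) \<Rightarrow> real \<Rightarrow> nat \<Rightarrow> (nat \<Rightarrow> 'a set)
    \<Rightarrow> (nat \<Rightarrow> ('a, 'b) pre_digraph) \<Rightarrow> bool" where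
  "mlgs_optimal G c t l T Gs \<longleftrightarrow>
     mlgs_feasible G c t l T Gs \<and>
     (\<forall>Hs. mlgs_feasible G c t l T Hs \<longrightarrow> mlgs_cost c l Gs \<le> mlgs_cost c l Hs)"

text \<open>The minimum-cost spanners chosen by the oracle need not be unique; every choice is allowed.\<close>

definition oracle_top_down ::
  "('a, 'b) pre_digraph \<Rightarrow> ('a set \<Rightarrow> real) \<Rightarrow> real \<Rightarrow> nat \<Rightarrow> (nat \<Rightarrow> 'a set)
    \<Rightarrow> (nat \<Rightarrow> ('a, 'b) pre_digraph) \<Rightarrow> bool" where
  "oracle_top_down G c t l T Gs \<longleftrightarrow>
     min_cost_subset_spanner G c t (T l) (Gs l) \<and>
     (\<forall>i\<in>{1..<l}. \<exists>H. min_cost_subset_spanner G c t (T i) H \<and> Gs i = union (Gs (Suc i)) H)"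

text \<open>Total weight of the edges of level \<open>i\<close> that are not in level \<open>i + 1\<close>; level \<open>l + 1\<close> is empty.\<close>

definition layer_cost ::
  "('a set \<Rightarrow> real) \<Rightarrow> nat \<Rightarrow> (nat \<Rightarrow> ('a, 'b) pre_digraph) \<Rightarrow> nat \<Rightarrow> real" where
  "layer_cost c l Gs i =
     (\<Sum>e \<in> edges (Gs i) - (if i = l then {} else edges (Gs (Suc i))). c e)"

lemma mlgs_cost_eq_sum_layer_cost:
  assumes fin: "\<And>i. i \<in> {1..l} \<Longrightarrow> finite (edges (Gs i))"
    and nested: "\<And>i. i \<in> {1..<l} \<Longrightarrow> edges (Gs (Suc i)) \<subseteq> edges (Gs i)"
  shows "mlgs_cost c l Gs = (\<Sum>i=1..l. real i * layer_cost c l Gs i)"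
proof -
  define g where "g i = (if i \<le> l then cost c (Gs i) else 0)" for i
  have layer: "layer_cost c l Gs i = g i - g (Suc i)" if "i \<in> {1..l}" for i
  proof (cases "i = l")
    case True
    then show ?thesis by (simp add: layer_cost_def g_def cost_def)
  next
    case False
    then have "i \<in> {1..<l}" using that by auto
    then show ?thesis using False that fin nested[of i]
      by (simp add: layer_cost_def g_def cost_def sum_diff)
  qed
  have "(\<Sum>i=1..n. real i * (g i - g (Suc i))) = (\<Sum>i=1..n. g i) - real n * g (Suc n)" for n
    by (induction n) (simp_all add: algebra_simps)
  from this[of l] have "(\<Sum>i=1..l. real i * (g i - g (Suc i))) = (\<Sum>i=1..l. g i)"
    by (simp add: g_def)
  then show ?thesis by (simp add: layer mlgs_cost_def g_def)
qed

lemma finite_edges: "graph H \<Longrightarrow> finite (edges H)"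
  by (simp add: edges_def graph_def digraph_def fin_digraph.finite_arcs)

lemma edges_subgraph: "subgraph H G \<Longrightarrow> edges H \<subseteq> edges G"
  by (auto simp: edges_def subgraph_def compatible_def)

lemma mlgs_feasible_cost_eq:
  assumes "mlgs_feasible G c t l T Gs"
  shows "mlgs_cost c l Gs = (\<Sum>i=1..l. real i * layer_cost c l Gs i)"
  using assms
  by (intro mlgs_cost_eq_sum_layer_cost)
     (auto simp: mlgs_feasible_def subset_spanner_def finite_edges dest!: bspec edges_subgraph)

lemma oracle_top_down_cost_eq:
  assumes "graph G" and alg: "oracle_top_down G c t l T Gs"
  shows "mlgs_cost c l Gs = (\<Sum>i=1..l. real i * layer_cost c l Gs i)"
proof (rule mlgs_cost_eq_sum_layer_cost)
  have sub: "subgraph (Gs i) G" if "i \<in> {1..l}" for i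
    using that
  proof (induction "l - i" arbitrary: i)
    case 0
    then show ?case
      using alg by (simp add: oracle_top_down_def min_cost_subset_spanner_def subset_spanner_def)
  next
    case (Suc k)
    then have "subgraph (Gs (Suc i)) G" by auto
    moreover obtain H where "subgraph H G" "Gs i = union (Gs (Suc i)) H"
      using alg Suc.prems Suc.hyps(2)
      unfolding oracle_top_down_def min_cost_subset_spanner_def subset_spanner_def
      by (metis atLeastAtMost_iff atLeastLessThan_iff zero_less_Suc zero_less_diff)
    ultimately show ?case
      by (metis subgraph_union subgraph_def compatible_def)
  qed
  show "finite (edges (Gs i))" if "i \<in> {1..l}" for i
    using finite_edges[OF assms(1)] edges_subgraph[OF sub[OF that]] by (rule finite_subset[rotated])
  show "edges (Gs (Suc i)) \<subseteq> edges (Gs i)" if "i \<in> {1..<l}" for i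
    using alg that by (auto simp: oracle_top_down_def edges_def union_def dest!: bspec)
qed

end

theory Submission
  imports Defs
begin

text \<open>
  The edges that the algorithm adds at level \<open>i\<close> belong to a minimum-cost spanner for \<open>T i\<close>, and the
  \<open>i\<close>-th level of an optimal solution is itself a spanner for \<open>T i\<close>. So \<open>TOP\<^sub>i\<close> is at most the cost
  \<open>C\<^sub>i\<close> of that level, and \<open>C\<^sub>i\<close> telescopes into \<open>OPT\<^sub>i + \<dots> + OPT\<^sub>l\<close>. As \<open>C\<^sub>i\<close> is antitone in \<open>i\<close>,
  Chebyshev's sum inequality bounds \<open>\<Sum> i TOP\<^sub>i \<le> \<Sum> i C\<^sub>i\<close> by the mean \<open>(l + 1) / 2\<close> of the
  levels times \<open>\<Sum> C\<^sub>i = OPT\<close>.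
\<close>

text \<open>Downward induction from \<open>l\<close>, where the layer is all of \<open>Gs l\<close>.
  Below it, nestedness and finiteness make each layer cost the difference of two consecutive level
  costs.\<close>

lemma mlgs_feasible_cost_eq_sum_layers:
  assumes feas: "mlgs_feasible G c t l T Gs" and "i \<in> {1..l}"
  shows "cost c (Gs i) = (\<Sum>j=i..l. layer_cost c l Gs j)"
proof -
  have "1 \<le> i" "i \<le> l" using assms(2) by auto
  from this(2,1) show ?thesis
  proof (induction i rule: inc_induct)
    case base
    then show ?case by (simp add: layer_cost_def cost_def)
  next
    case (step n)
    have "finite (edges (Gs n))"
      using feas step by (auto simp: mlgs_feasible_def subset_spanner_def intro!: finite_edges)
    moreover have "edges (Gs (Suc n)) \<subseteq> edges (Gs n)"
      using feas step by (auto simp: mlgs_feasible_def dest!: bspec edges_subgraph)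
    ultimately have "layer_cost c l Gs n = cost c (Gs n) - cost c (Gs (Suc n))"
      using step by (simp add: layer_cost_def cost_def sum_diff finite_subset)
    then show ?case
      using step by (simp add: sum.atLeast_Suc_atMost)
  qed
qed

lemma layer_cost_nonneg:
  assumes "\<forall>e\<in>edges (Gs i). 0 \<le> c e"
  shows "0 \<le> layer_cost c l Gs i"
  using assms by (auto simp: layer_cost_def intro!: sum_nonneg)

text \<open>Every level keeps the \<open>tail\<close> and \<open>head\<close> maps of
  \<open>G\<close>: the top level is a subgraph of \<open>G\<close>, and \<open>union\<close>
  inherits the maps of its first argument. This makes \<open>edges_union\<close> applicable to the
  levels.\<close>

lemma oracle_top_down_compatible:
  assumes alg: "oracle_top_down G c t l T Gs" and "i \<in> {1..l}"
  shows "compatible G (Gs i)"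
proof -
  have "1 \<le> i" "i \<le> l" using assms(2) by auto
  from this(2,1) show ?thesis
  proof (induction i rule: inc_induct)
    case base
    then show ?case
      using alg by (simp add: oracle_top_down_def min_cost_subset_spanner_def
          subset_spanner_def subgraph_def compatible_def)
  next
    case (step n)
    then have "n \<in> {1..<l}" by simp
    then obtain H where "Gs n = union (Gs (Suc n)) H"
      using alg by (meson oracle_top_down_def)
    then show ?case
      using step by (simp add: compatible_def)
  qed
qed

text \<open>\<open>union\<close> reads all arcs with the maps of \<open>G1\<close>, so the arcs of
  \<open>G2\<close> keep their endpoints only if the maps agree.\<close>

lemma edges_union:
  assumes "compatible G1 G2"
  shows "edges (union G1 G2) = edges G1 \<union> edges G2"
  using assms by (simp add: edges_def compatible_def image_Un)

lemma layer_cost_oracle_top_down_le: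
  assumes "graph G" and nonneg: "\<forall>e\<in>edges G. 0 \<le> c e"
    and alg: "oracle_top_down G c t l T Gs"
    and "i \<in> {1..l}" and K: "subset_spanner G c t (T i) K"
  shows "layer_cost c l Gs i \<le> cost c K"
proof -
  \<comment> \<open>\<open>H\<close> is the spanner chosen by the oracle at level \<open>i\<close>;
    at the top level it is \<open>Gs l\<close> itself.\<close>
  obtain H where H: "min_cost_subset_spanner G c t (T i) H"
    and new: "edges (Gs i) - (if i = l then {} else edges (Gs (Suc i))) \<subseteq> edges H"
  proof (cases "i = l")
    case True
    then show ?thesis using that alg by (auto simp: oracle_top_down_def)
  next
    case False
    then have i: "i \<in> {1..<l}" using assms(4) by simp
    then obtain H where H: "min_cost_subset_spanner G c t (T i) H"
      and Gi: "Gs i = union (Gs (Suc i)) H"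
      using alg by (meson oracle_top_down_def)
    have "compatible G H"
      using H by (simp add: min_cost_subset_spanner_def subset_spanner_def subgraph_def compatible_def)
    moreover have "compatible G (Gs (Suc i))"
      using oracle_top_down_compatible[OF alg] i by simp
    ultimately have "edges (Gs i) = edges (Gs (Suc i)) \<union> edges H"
      unfolding Gi by (intro edges_union) (simp add: compatible_def)
    then show ?thesis using that H False by auto
  qed
  have "subgraph H G"
    using H by (simp add: min_cost_subset_spanner_def subset_spanner_def)
  then have "edges H \<subseteq> edges G" by (rule edges_subgraph)
  then have "layer_cost c l Gs i \<le> cost c H"
    unfolding layer_cost_def cost_def
    using new nonneg finite_edges[OF assms(1)] by (intro sum_mono2) (auto intro: finite_subset)
  also have "\<dots> \<le> cost c K"
    using H K by (simp add: min_cost_subset_spanner_def)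
  finally show ?thesis .
qed

lemma sum_index_mult_antitone_le:
  fixes b :: "nat \<Rightarrow> real"
  assumes "\<And>i j. 1 \<le> i \<Longrightarrow> i \<le> j \<Longrightarrow> j \<le> l \<Longrightarrow> b j \<le> b i"
  shows "(\<Sum>i=1..l. real i * b i) \<le> (real l + 1) / 2 * (\<Sum>i=1..l. b i)"
proof (cases "l = 0")
  case False
  \<comment> \<open>Chebyshev's inequality is stated for sums over \<open>0..<l\<close>.\<close>
  have shift: "(\<Sum>i=1..l. f i) = (\<Sum>i=0..<l. f (Suc i))" for f :: "nat \<Rightarrow> real"
    using sum.atLeast_Suc_lessThan_Suc_shift[of f 0 l] by (simp add: atLeastLessThanSuc_atLeastAtMost)
  have gauss: "(\<Sum>k=0..<l. real (Suc k)) = real l * (real l + 1) / 2"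
    by (induction l) (simp_all add: field_simps)
  \<comment> \<open>The two factors are oppositely ordered: the indices increase while
    \<open>b\<close> decreases. The factor \<open>real l\<close> cancels at the end since
    \<open>l\<close> is nonzero.\<close>
  have "real l * (\<Sum>k=0..<l. real (Suc k) * b (Suc k))
      \<le> (\<Sum>k=0..<l. real (Suc k)) * (\<Sum>k=0..<l. b (Suc k))"
    using assms by (intro Chebyshev_sum_upper) auto
  then have "real l * (\<Sum>i=1..l. real i * b i) \<le> real l * ((real l + 1) / 2 * (\<Sum>i=1..l. b i))"
    unfolding shift gauss by (simp add: mult.assoc)
  then show ?thesis using False by simp
qed simp

theorem theorem3:
  fixes G :: "('a, 'b) pre_digraph"
    and c :: "'a set \<Rightarrow> real"
    and t :: real
    and l :: nat
    and T :: "nat \<Rightarrow> 'a set"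
    and Gs Gopt :: "nat \<Rightarrow> ('a, 'b) pre_digraph"
  assumes "graph G"
    and "\<forall>e\<in>edges G. 0 < c e"
    and "1 \<le> t"
    and "1 \<le> l"
    and "T 1 \<subseteq> verts G"
    and "\<forall>i\<in>{1..<l}. T (Suc i) \<subseteq> T i"
    and "oracle_top_down G c t l T Gs"
    and "mlgs_optimal G c t l T Gopt"
  shows "layer_cost c l Gs l \<le> layer_cost c l Gopt l
    \<and> (\<forall>i\<in>{1..<l}. layer_cost c l Gs i \<le> (\<Sum>j=i..l. layer_cost c l Gopt j))
    \<and> mlgs_cost c l Gs \<le> (real l + 1) / 2 * mlgs_cost c l Gopt"
proof -
  have feas: "mlgs_feasible G c t l T Gopt"
    using assms(8) by (simp add: mlgs_optimal_def)
  have nonneg: "\<forall>e\<in>edges G. 0 \<le> c e"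
    using assms(2) by (auto intro: less_imp_le)
  note cost_opt = mlgs_feasible_cost_eq_sum_layers[OF feas]
  have le: "layer_cost c l Gs i \<le> cost c (Gopt i)" if "i \<in> {1..l}" for i
    using layer_cost_oracle_top_down_le[OF assms(1) nonneg assms(7) that] feas that
    by (simp add: mlgs_feasible_def)
  have "0 \<le> layer_cost c l Gopt i" if "i \<in> {1..l}" for i
    using feas that nonneg edges_subgraph
    by (intro layer_cost_nonneg) (force simp: mlgs_feasible_def subset_spanner_def)
  \<comment> \<open>Passing from \<open>i\<close> to \<open>j\<close> only drops nonnegative layers
    from the sum.\<close>
  then have antitone: "cost c (Gopt j) \<le> cost c (Gopt i)" if "1 \<le> i" "i \<le> j" "j \<le> l" for i j
    using that by (auto simp: cost_opt intro!: sum_mono2)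
  have "mlgs_cost c l Gs = (\<Sum>i=1..l. real i * layer_cost c l Gs i)"
    using oracle_top_down_cost_eq[OF assms(1,7)] .
  also have "\<dots> \<le> (\<Sum>i=1..l. real i * cost c (Gopt i))"
    by (intro sum_mono mult_left_mono le) auto
  also have "\<dots> \<le> (real l + 1) / 2 * mlgs_cost c l Gopt"
    unfolding mlgs_cost_def by (rule sum_index_mult_antitone_le) (rule antitone)
  \<comment> \<open>The first two claims are \<open>le\<close> rewritten by \<open>cost_opt\<close>;
    for \<open>i = l\<close> the sum has a single layer.\<close>
  finally show ?thesis
    using le le[of l] cost_opt assms(4) by auto
qed

end
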